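(* Let $G$ be a totally disconnected locally compact group with meet groupoid $\mathcal{W}=\mathcal{W}(G)$. Let $\mathcal{CSI}(\mathcal{W})$ be the set of closed-subgroup ideals of $\mathcal{W}$, with the subspace topology inherited from the product topology on the power set $\mathcal{P}(\mathcal{W})=\{0,1\}^{\mathcal{W}}$, and let $\mathcal{S}(G)$ be the Chabauty space of $G$. Then the map $\Gamma:\mathcal{CSI}(\mathcal{W})\to\mathcal{S}(G)$ given by $\mathcal{J}\mapsto S_{\mathcal{J}}=G\setminus\bigcup\mathcal{J}$ is a continuous bijection of compact spaces, and hence a homeomorphism.
   Context: $\mathcal{W}(G)$ has as its elements the compact open cosets in $G$ (cosets of compact open subgroups) together with $\emptyset$, with intersection as the meet operation. The product $A\cdot B$ of nonempty $A,B\in\mathcal{W}(G)$ is defined if and only if there is a subgroup $U$ such that $A$ is a left coset of $U$ and $B$ is a right coset of $U$; in that case $A\cdot B$ is the usual product of subsets of $G$. Also $\emptyset\cdot\emptyset=\emptyset$, and no other products involving $\emptyset$ are defined. The inverse is $A^{-1}=\{g^{-1}:g\in A\}$. A set $\mathcal{J}\subseteq\mathcal{W}$ is an ideal of $\mathcal{W}$ if $\emptyset\in\mathcal{J}$ and, whenever $B_1,\dots,B_n\in\mathcal{J}$, $A\in\mathcal{W}$ and $A\subseteq\bigcup_i B_i$, then $A\in\mathcal{J}$. A closed-subgroup ideal is an ideal $\mathcal{J}$ that is closed under inversion $A\mapsto A^{-1}$ and such that for nonempty $A,B\in\mathcal{W}$, if $A\cdot B$ is defined and $A\cdot B\in\mathcal{J}$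 then $A\in\mathcal{J}$ or $B\in\mathcal{J}$. The Chabauty space $\mathcal{S}(G)$ is the set of closed subgroups of $G$ with the topology whose basic open sets are $\Omega(K;R_1,\dots,R_n)=\{U \text{ closed subgroup of } G: U\cap K=\emptyset \text{ and } U\cap R_i\neq\emptyset \text{ for all } i\le n\}$, for $K\subseteq G$ compact and $R_1,\dots,R_n\subseteq G$ open.
   Formalization: Closed-subgroup ideals are additionally required to be proper (J ≠ W): the improper ideal J = W meets the stated definition, but G \ ⋃W is empty and hence not a subgroup. *)

theory Defs
  imports "HOL-Analysis.Analysis" "HOL-Algebra.Left_Coset"
begin

section \<open>Totally disconnected locally compact groups\<close>

locale topological_group = group G for G (structure) and T :: "'a topology" +
  assumes topspace_eq_carrier: "topspace T = carrier G"
    and continuous_map_mult: "continuous_map (prod_topology T T) T (\<lambda>(x, y). x \<otimes> y)"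
    and continuous_map_inv: "continuous_map T T (\<lambda>x. inv x)"

definition totally_disconnected_space :: "'a topology \<Rightarrow> bool" where
  "totally_disconnected_space T \<longleftrightarrow> (\<forall>x\<in>topspace T. connected_component_of_set T x = {x})"

text \<open>The Hausdorff property is not assumed separately: connected components are closed, so a
  totally disconnected topological group is T1 and hence Hausdorff.\<close>

locale tdlc_group = topological_group +
  assumes locally_compact: "locally_compact_space T"
    and totally_disconnected: "totally_disconnected_space T"

section \<open>The meet groupoid\<close>

definition compact_open_subgroup :: "('a, 'b) monoid_scheme \<Rightarrow> 'a topology \<Rightarrow> 'a set \<Rightarrow> bool" where
  "compact_open_subgroup G T U \<longleftrightarrow> subgroup U G \<and> compactin T U \<and> openin T U"

definition meet_groupoid :: "('a, 'b) monoid_scheme \<Rightarrow> 'a topology \<Rightarrow> 'a set set" where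
  "meet_groupoid G T =
     insert {} {A. \<exists>U. compact_open_subgroup G T U \<and> (A \<in> lcosets\<^bsub>G\<^esub> U \<or> A \<in> rcosets\<^bsub>G\<^esub> U)}"

text \<open>The partial product of the meet groupoid; \<open>None\<close> means undefined. Cosets are nonempty, so the
  only defined product involving \<open>{}\<close> is \<open>{} \<cdot> {}\<close>. The meet operation is intersection, so the
  induced order is inclusion of sets, and the groupoid inverse is \<open>set_inv\<close>.\<close>

definition mg_product ::
    "('a, 'b) monoid_scheme \<Rightarrow> 'a set \<Rightarrow> 'a set \<Rightarrow> 'a set option" where
  "mg_product G A B =
     (if A = {} \<and> B = {} then Some {}
      else if \<exists>U. subgroup U G \<and> A \<in> lcosets\<^bsub>G\<^esub> U \<and> B \<in> rcosets\<^bsub>G\<^esub> U then Some (A <#>\<^bsub>G\<^esub> B)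
      else None)"

section \<open>Closed-subgroup ideals\<close>

definition mg_ideal :: "'a set set \<Rightarrow> 'a set set \<Rightarrow> bool" where
  "mg_ideal W J \<longleftrightarrow> J \<subseteq> W \<and> {} \<in> J \<and>
     (\<forall>A F. finite F \<and> F \<subseteq> J \<and> A \<in> W \<and> A \<subseteq> \<Union>F \<longrightarrow> A \<in> J)"

text \<open>Closed-subgroup ideals are required to be proper. The improper ideal satisfies all the other
  conditions, but the complement of its union is empty and so not a subgroup.\<close>

definition closed_subgroup_ideals ::
    "('a, 'b) monoid_scheme \<Rightarrow> 'a topology \<Rightarrow> 'a set set set" where
  "closed_subgroup_ideals G T =
     {J. mg_ideal (meet_groupoid G T) J \<and> J \<noteq> meet_groupoid G T \<and>
         (\<forall>A\<in>J. set_inv\<^bsub>G\<^esub> A \<in> J) \<and>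
         (\<forall>A \<in> meet_groupoid G T - {{}}. \<forall>B \<in> meet_groupoid G T - {{}}. \<forall>C.
            mg_product G A B = Some C \<and> C \<in> J \<longrightarrow> A \<in> J \<or> B \<in> J)}"

text \<open>The power set of \<open>W\<close> with the product topology of \<open>{0,1}\<^sup>W\<close>, transported along the
  identification of a subset with its characteristic function.\<close>

definition powerset_topology :: "'w set \<Rightarrow> 'w set topology" where
  "powerset_topology W =
     pullback_topology (Pow W) (\<lambda>J. \<lambda>A\<in>W. A \<in> J)
       (product_topology (\<lambda>_. discrete_topology (UNIV :: bool set)) W)"

definition csi_topology ::
    "('a, 'b) monoid_scheme \<Rightarrow> 'a topology \<Rightarrow> 'a set set topology" where
  "csi_topology G T =
     subtopology (powerset_topology (meet_groupoid G T)) (closed_subgroup_ideals G T)"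

section \<open>The Chabauty space\<close>

definition closed_subgroups :: "('a, 'b) monoid_scheme \<Rightarrow> 'a topology \<Rightarrow> 'a set set" where
  "closed_subgroups G T = {U. subgroup U G \<and> closedin T U}"

definition chabauty_basic ::
    "('a, 'b) monoid_scheme \<Rightarrow> 'a topology \<Rightarrow> 'a set \<Rightarrow> 'a set set \<Rightarrow> 'a set set" where
  "chabauty_basic G T K \<R> =
     {U \<in> closed_subgroups G T. U \<inter> K = {} \<and> (\<forall>R\<in>\<R>. U \<inter> R \<noteq> {})}"

definition is_chabauty_basic ::
    "('a, 'b) monoid_scheme \<Rightarrow> 'a topology \<Rightarrow> 'a set set \<Rightarrow> bool" where
  "is_chabauty_basic G T X \<longleftrightarrow>
     (\<exists>K \<R>. compactin T K \<and> finite \<R> \<and> (\<forall>R\<in>\<R>. openin T R) \<and> X = chabauty_basic G T K \<R>)"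

definition chabauty_topology ::
    "('a, 'b) monoid_scheme \<Rightarrow> 'a topology \<Rightarrow> 'a set topology" where
  "chabauty_topology G T = topology (arbitrary union_of is_chabauty_basic G T)"

lemma openin_chabauty_topology:
  "openin (chabauty_topology G T) = arbitrary union_of is_chabauty_basic G T"
proof -
  have "is_chabauty_basic G T (X \<inter> Y)"
    if "is_chabauty_basic G T X" and "is_chabauty_basic G T Y" for X Y
  proof -
    from that obtain K \<R> L \<S> where *: "compactin T K" "finite \<R>" "\<forall>R\<in>\<R>. openin T R"
      "X = chabauty_basic G T K \<R>" "compactin T L" "finite \<S>" "\<forall>R\<in>\<S>. openin T R"
      "Y = chabauty_basic G T L \<S>"
      unfolding is_chabauty_basic_def by metis
    have "X \<inter> Y = chabauty_basic G T (K \<union> L) (\<R> \<union> \<S>)"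
      using * by (auto simp: chabauty_basic_def)
    with * show ?thesis
      unfolding is_chabauty_basic_def
      by (intro exI[of _ "K \<union> L"] exI[of _ "\<R> \<union> \<S>"]) (auto simp: compactin_Un)
  qed
  then show ?thesis
    unfolding chabauty_topology_def
    by (intro topology_inverse' istopology_base) auto
qed

lemma topspace_chabauty_topology: "topspace (chabauty_topology G T) = closed_subgroups G T"
proof -
  have "is_chabauty_basic G T (closed_subgroups G T)"
    unfolding is_chabauty_basic_def
    by (intro exI[of _ "{}"]) (auto simp: chabauty_basic_def)
  then have "openin (chabauty_topology G T) (closed_subgroups G T)"
    by (simp add: openin_chabauty_topology arbitrary_def union_of_inc)
  moreover have "X \<subseteq> closed_subgroups G T" if "openin (chabauty_topology G T) X" for X
    using that by (auto simp: openin_chabauty_topology union_of_def is_chabauty_basic_def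
        chabauty_basic_def)
  ultimately show ?thesis
    by (meson openin_subset openin_topspace subset_antisym)
qed

lemma topspace_csi_topology: "topspace (csi_topology G T) = closed_subgroup_ideals G T"
  by (auto simp: csi_topology_def powerset_topology_def topspace_pullback_topology
      closed_subgroup_ideals_def mg_ideal_def)

section \<open>The map from closed-subgroup ideals to closed subgroups\<close>

definition ideal_subgroup :: "('a, 'b) monoid_scheme \<Rightarrow> 'a set set \<Rightarrow> 'a set" where
  "ideal_subgroup G J = carrier G - \<Union>J"

end

theory Submission
  imports Defs
begin

text \<open>The inverse of \<open>\<Gamma>\<close> sends a closed subgroup \<open>S\<close> to the ideal of all compact open cosets avoiding \<open>S\<close>.
  By van Dantzig's theorem the compact open cosets form a base of the topology, so this ideal covers
  the complement of \<open>S\<close>. Conversely a compact coset covered by \<open>J\<close> is covered by finitely many members of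
  \<open>J\<close> and hence belongs to \<open>J\<close>. Closure of \<open>S\<^sub>J\<close> under multiplication comes from writing a coset
  \<open>abU\<close> as the product \<open>aV \<cdot> bU\<close>, which is defined for \<open>V = bUb\<inverse>\<close>. The closed-subgroup ideals are cut
  out of \<open>{0,1}\<^sup>W\<close> by conditions on finitely many coordinates each, hence form a compact space,
  which \<open>\<Gamma>\<close> maps continuously and bijectively onto a Hausdorff space.\<close>

no_notation subset_mset (infix \<open><#\<close> 50)

section \<open>Topological groups\<close>

context topological_group
begin

lemma continuous_map_op:
  assumes "continuous_map X T f" "continuous_map X T g"
  shows "continuous_map X T (\<lambda>x. f x \<otimes> g x)"
  using continuous_map_compose[OF continuous_map_pairedI[OF assms] continuous_map_mult]
  by (simp add: o_def)

lemma continuous_map_left_translation: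
  assumes "a \<in> carrier G"
  shows "continuous_map T T (\<lambda>x. a \<otimes> x)"
  using assms by (intro continuous_map_op) (auto simp: topspace_eq_carrier)

lemma continuous_map_right_translation:
  assumes "a \<in> carrier G"
  shows "continuous_map T T (\<lambda>x. x \<otimes> a)"
  using assms by (intro continuous_map_op) (auto simp: topspace_eq_carrier)

text \<open>Presents a translate by \<open>a\<close> as a preimage under translation by
  \<open>inv a\<close>, so that openness of cosets follows from continuity; compactness uses the
  image form instead.\<close>

lemma l_coset_eq_preimage:
  assumes "a \<in> carrier G" "U \<subseteq> carrier G"
  shows "a <# U = {x \<in> carrier G. inv a \<otimes> x \<in> U}"
proof (intro equalityI subsetI)
  fix x assume "x \<in> {x \<in> carrier G. inv a \<otimes> x \<in> U}"
  moreover from this have "x = a \<otimes> (inv a \<otimes> x)"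
    using assms by (simp add: m_assoc[symmetric])
  ultimately show "x \<in> a <# U"
    unfolding l_coset_def by blast
qed (use assms in \<open>auto simp: l_coset_def m_assoc[symmetric] subsetD\<close>)

lemma r_coset_eq_preimage:
  assumes "a \<in> carrier G" "U \<subseteq> carrier G"
  shows "U #> a = {x \<in> carrier G. x \<otimes> inv a \<in> U}"
proof (intro equalityI subsetI)
  fix x assume "x \<in> {x \<in> carrier G. x \<otimes> inv a \<in> U}"
  moreover from this have "x = (x \<otimes> inv a) \<otimes> a"
    using assms by (simp add: m_assoc)
  ultimately show "x \<in> U #> a"
    unfolding r_coset_def by blast
qed (use assms in \<open>auto simp: r_coset_def m_assoc subsetD\<close>)

lemma openin_l_coset:
  assumes "a \<in> carrier G" "openin T U"
  shows "openin T (a <# U)"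
  using openin_continuous_map_preimage[OF continuous_map_left_translation assms(2), of "inv a"] assms
    openin_subset[OF assms(2)]
  by (simp add: l_coset_eq_preimage topspace_eq_carrier)

lemma openin_r_coset:
  assumes "a \<in> carrier G" "openin T U"
  shows "openin T (U #> a)"
  using openin_continuous_map_preimage[OF continuous_map_right_translation assms(2), of "inv a"] assms
    openin_subset[OF assms(2)]
  by (simp add: r_coset_eq_preimage topspace_eq_carrier)

lemma compactin_l_coset:
  assumes "a \<in> carrier G" "compactin T U"
  shows "compactin T (a <# U)"
  using image_compactin[OF assms(2) continuous_map_left_translation[OF assms(1)]]
  by (simp add: l_coset_def UNION_singleton_eq_range)

lemma compactin_r_coset:
  assumes "a \<in> carrier G" "compactin T U"
  shows "compactin T (U #> a)"
  using image_compactin[OF assms(2) continuous_map_right_translation[OF assms(1)]]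
  by (simp add: r_coset_def UNION_singleton_eq_range)

section \<open>Inverses, products and conjugates of cosets\<close>

lemma m_inv_image_subgroup:
  assumes "subgroup U G"
  shows "(\<lambda>u. inv u) ` U = U"
proof (intro equalityI subsetI)
  fix u assume u: "u \<in> U"
  then have "u = inv (inv u)"
    using assms by (simp add: subgroup.mem_carrier)
  then show "u \<in> (\<lambda>u. inv u) ` U"
    using subgroup.m_inv_closed[OF assms u] by (rule image_eqI)
qed (use assms in \<open>auto intro: subgroup.m_inv_closed\<close>)

lemma set_inv_l_coset:
  assumes "subgroup U G" "a \<in> carrier G"
  shows "set_inv (a <# U) = U #> inv a"
proof -
  have "inv (a \<otimes> u) = inv u \<otimes> inv a" if "u \<in> U" for u
    using that assms by (simp add: inv_mult_group subgroup.mem_carrier)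
  then show ?thesis
    using m_inv_image_subgroup[OF assms(1)] unfolding SET_INV_def l_coset_def r_coset_def by force
qed

text \<open>The two inner copies of \<open>U\<close> merge into one because \<open>U\<close> is
  closed under multiplication; for the reverse inclusion, \<open>a\<close> itself serves as the
  element of \<open>a <# U\<close>. All defined products of nonempty cosets have this shape.\<close>

lemma set_mult_l_coset_r_coset:
  assumes "subgroup U G" "a \<in> carrier G" "b \<in> carrier G"
  shows "(a <# U) <#> (U #> b) = a <# (U #> b)"
proof (intro equalityI subsetI)
  fix x assume "x \<in> (a <# U) <#> (U #> b)"
  then obtain u v where uv: "u \<in> U" "v \<in> U" "x = (a \<otimes> u) \<otimes> (v \<otimes> b)"
    by (auto simp: set_mult_def l_coset_def r_coset_def)
  then have "x = a \<otimes> ((u \<otimes> v) \<otimes> b)"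
    using assms by (simp add: m_assoc subgroup.mem_carrier)
  moreover have "u \<otimes> v \<in> U"
    using uv assms(1) by (simp add: subgroup.m_closed)
  ultimately show "x \<in> a <# (U #> b)"
    by (auto simp: l_coset_def r_coset_def)
next
  fix x assume "x \<in> a <# (U #> b)"
  then obtain u where "u \<in> U" "x = a \<otimes> (u \<otimes> b)"
    by (auto simp: l_coset_def r_coset_def)
  moreover have "a \<in> a <# U"
    using assms by (simp add: lcos_self)
  ultimately show "x \<in> (a <# U) <#> (U #> b)"
    by (auto simp: set_mult_def r_coset_def)
qed

lemma subgroup_conjugate:
  assumes "subgroup U G" "a \<in> carrier G"
  shows "subgroup ((a <# U) #> inv a) G"
proof -
  note U = subgroup.mem_carrier[OF assms(1)]
  have *: "(a <# U) #> inv a = {a \<otimes> u \<otimes> inv a |u. u \<in> U}"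
    by (auto simp: l_coset_def r_coset_def)
  show ?thesis
    unfolding *
  proof (rule subgroupI)
    show "{a \<otimes> u \<otimes> inv a |u. u \<in> U} \<subseteq> carrier G"
      using assms(2) U by auto
    show "{a \<otimes> u \<otimes> inv a |u. u \<in> U} \<noteq> {}"
      using subgroup.one_closed[OF assms(1)] by auto
  next
    fix x assume "x \<in> {a \<otimes> u \<otimes> inv a |u. u \<in> U}"
    then obtain u where u: "u \<in> U" "x = a \<otimes> u \<otimes> inv a" by blast
    then have "inv x = a \<otimes> inv u \<otimes> inv a"
      using assms(2) U by (simp add: inv_mult_group m_assoc)
    then show "inv x \<in> {a \<otimes> u \<otimes> inv a |u. u \<in> U}"
      using subgroup.m_inv_closed[OF assms(1) u(1)] by blast
  next
    fix x y assume "x \<in> {a \<otimes> u \<otimes> inv a |u. u \<in> U}" "y \<in> {a \<otimes> u \<otimes> inv a |u. u \<in> U}"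
    then obtain u v where uv: "u \<in> U" "x = a \<otimes> u \<otimes> inv a" "v \<in> U" "y = a \<otimes> v \<otimes> inv a"
      by blast
    have "inv a \<otimes> (a \<otimes> (v \<otimes> inv a)) = v \<otimes> inv a"
      using assms(2) U uv by (simp add: m_assoc[symmetric])
    then have "x \<otimes> y = a \<otimes> (u \<otimes> v) \<otimes> inv a"
      using assms(2) U uv by (simp add: m_assoc)
    then show "x \<otimes> y \<in> {a \<otimes> u \<otimes> inv a |u. u \<in> U}"
      using subgroup.m_closed[OF assms(1) uv(1,3)] by blast
  qed
qed

lemma compact_open_subgroup_conjugate:
  assumes "compact_open_subgroup G T U" "a \<in> carrier G"
  shows "compact_open_subgroup G T ((a <# U) #> inv a)"
  using assms unfolding compact_open_subgroup_def
  by (simp add: subgroup_conjugate openin_l_coset openin_r_coset compactin_l_coset compactin_r_coset)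

text \<open>Inserting \<open>inv a \<otimes> a\<close> on the right turns a left coset into a right
  coset of the conjugate subgroup. This is how a left coset becomes admissible as the second factor
  of a product.\<close>

lemma l_coset_eq_r_coset_conjugate:
  assumes "U \<subseteq> carrier G" "a \<in> carrier G"
  shows "a <# U = ((a <# U) #> inv a) #> a"
  using assms by (simp add: coset_mult_assoc l_coset_subset_G)

section \<open>Compact open cosets\<close>

lemma l_coset_in_meet_groupoid:
  assumes "compact_open_subgroup G T U" "a \<in> carrier G"
  shows "a <# U \<in> meet_groupoid G T"
  using assms unfolding meet_groupoid_def LCOSETS_def by blast

lemma r_coset_in_meet_groupoid:
  assumes "compact_open_subgroup G T U" "a \<in> carrier G"
  shows "U #> a \<in> meet_groupoid G T"
  using assms unfolding meet_groupoid_def RCOSETS_def by blast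

lemma compact_open_subgroup_in_meet_groupoid:
  assumes "compact_open_subgroup G T U"
  shows "U \<in> meet_groupoid G T"
  using l_coset_in_meet_groupoid[OF assms one_closed] assms
  by (simp add: compact_open_subgroup_def lcos_mult_one subgroup.subset)

lemma meet_groupoid_openin: "A \<in> meet_groupoid G T \<Longrightarrow> openin T A"
  by (auto simp: meet_groupoid_def LCOSETS_def RCOSETS_def compact_open_subgroup_def
      openin_l_coset openin_r_coset)

lemma meet_groupoid_compactin: "A \<in> meet_groupoid G T \<Longrightarrow> compactin T A"
  by (auto simp: meet_groupoid_def LCOSETS_def RCOSETS_def compact_open_subgroup_def
      compactin_l_coset compactin_r_coset)

lemma meet_groupoid_subset: "A \<in> meet_groupoid G T \<Longrightarrow> A \<subseteq> carrier G"
  using meet_groupoid_openin openin_subset topspace_eq_carrier by blast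

text \<open>A coset can be based at any of its points, and a right coset of \<open>U\<close> through
  \<open>x\<close> is the left coset at \<open>x\<close> of the conjugate of \<open>U\<close> by
  \<open>inv x\<close>. Later arguments can thus work with left cosets throughout.\<close>

lemma meet_groupoid_l_cosetE:
  assumes "A \<in> meet_groupoid G T" "x \<in> A"
  obtains U where "compact_open_subgroup G T U" "A = x <# U"
proof -
  from assms obtain U where U: "compact_open_subgroup G T U" "A \<in> lcosets U \<or> A \<in> rcosets U"
    unfolding meet_groupoid_def by auto
  then have sub: "subgroup U G"
    by (simp add: compact_open_subgroup_def)
  have x: "x \<in> carrier G"
    using assms meet_groupoid_subset by blast
  from U(2) show thesis
  proof
    assume "A \<in> lcosets U"
    then have "A = x <# U"
      using assms(2) l_repr_independence sub by (auto simp: LCOSETS_def)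
    with U(1) show thesis by (rule that)
  next
    assume "A \<in> rcosets U"
    then have A: "A = U #> x"
      using assms(2) repr_independence sub by (auto simp: RCOSETS_def)
    have "x <# ((inv x <# U) #> x) = A"
      using x sub subgroup.subset[OF sub]
      by (simp add: A coset_assoc l_coset_subset_G r_coset_subset_G lcos_m_assoc lcos_mult_one)
    with compact_open_subgroup_conjugate[OF U(1), of "inv x"] x show thesis
      by (intro that) auto
  qed
qed

lemma set_inv_in_meet_groupoid:
  assumes "A \<in> meet_groupoid G T"
  shows "set_inv A \<in> meet_groupoid G T"
proof (cases "A = {}")
  case True
  then show ?thesis by (simp add: SET_INV_def meet_groupoid_def)
next
  case False
  then obtain x where "x \<in> A" by blast
  with assms obtain U where "compact_open_subgroup G T U" "A = x <# U"
    by (rule meet_groupoid_l_cosetE)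
  moreover have "x \<in> carrier G"
    using \<open>x \<in> A\<close> assms meet_groupoid_subset by blast
  ultimately show ?thesis
    by (simp add: r_coset_in_meet_groupoid set_inv_l_coset compact_open_subgroup_def)
qed

text \<open>By the choice of \<open>V\<close>, the coset \<open>b <# U\<close> equals
  \<open>V #> b\<close>, so the subgroup linking the two factors is \<open>V\<close>. The
  factorization is used for arbitrary \<open>a\<close>, \<open>b\<close> in the closure of
  \<open>S_J\<close> under products, and with \<open>inv a\<close>, \<open>a\<close> to obtain
  \<open>U\<close> itself as a product.\<close>

lemma mg_product_factorization:
  assumes "compact_open_subgroup G T U" "a \<in> carrier G" "b \<in> carrier G"
  defines "V \<equiv> (b <# U) #> inv b"
  shows "mg_product G (a <# V) (b <# U) = Some ((a \<otimes> b) <# U)"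
    and "a <# V \<in> meet_groupoid G T"
proof -
  have V: "compact_open_subgroup G T V"
    unfolding V_def using assms by (intro compact_open_subgroup_conjugate)
  then show "a <# V \<in> meet_groupoid G T"
    using assms by (intro l_coset_in_meet_groupoid)
  have sub: "subgroup U G" "subgroup V G"
    using assms(1) V by (auto simp: compact_open_subgroup_def)
  have b: "b <# U = V #> b"
    unfolding V_def using sub assms by (intro l_coset_eq_r_coset_conjugate subgroup.subset)
  have "(a <# V) <#> (b <# U) = (a \<otimes> b) <# U"
    using set_mult_l_coset_r_coset[OF sub(2) assms(2,3)] assms(2,3) sub
    by (simp add: b[symmetric] lcos_m_assoc subgroup.subset)
  \<comment> \<open>Nonemptiness rules out the branch of \<open>mg_product\<close> for two empty
    sets.\<close>
  moreover have "a \<in> a <# V"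
    using assms sub by (simp add: lcos_self)
  moreover have "a <# V \<in> lcosets V" "b <# U \<in> rcosets V"
    using assms by (auto simp: LCOSETS_def RCOSETS_def b)
  ultimately show "mg_product G (a <# V) (b <# U) = Some ((a \<otimes> b) <# U)"
    using sub unfolding mg_product_def by auto
qed

end

section \<open>Van Dantzig's theorem\<close>

context tdlc_group
begin

text \<open>Components are closed, so the identity is a closed point, and the diagonal is its
  preimage under the map taking \<open>(x, y)\<close> to \<open>x \<otimes> inv y\<close>.\<close>

lemma Hausdorff: "Hausdorff_space T"
proof -
  have "connected_component_of_set T \<one> = {\<one>}"
    using totally_disconnected by (simp add: totally_disconnected_space_def topspace_eq_carrier)
  then have "closedin T {\<one>}"
    by (metis closedin_connected_component_of)
  moreover have "continuous_map (prod_topology T T) T (\<lambda>p. fst p \<otimes> inv (snd p))"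
    by (intro continuous_map_op continuous_map_fst continuous_map_compose[OF continuous_map_snd continuous_map_inv, unfolded o_def])
  ultimately have "closedin (prod_topology T T)
      {p \<in> topspace (prod_topology T T). fst p \<otimes> inv (snd p) \<in> {\<one>}}"
    by (intro closedin_continuous_map_preimage)
  also have "{p \<in> topspace (prod_topology T T). fst p \<otimes> inv (snd p) \<in> {\<one>}} = (\<lambda>x. (x, x)) ` topspace T"
    using inv_solve_right' by (force simp: topspace_eq_carrier image_iff)
  finally show ?thesis
    by (simp add: Hausdorff_space_closedin_diagonal)
qed

text \<open>In a locally compact Hausdorff space a compact component can be separated by a clopen
  set from any closed set disjoint from it; here the component is a point.\<close>

lemma compact_open_neighbourhood:
  assumes "openin T N" "x \<in> N"
  obtains K where "compactin T K" "openin T K" "x \<in> K" "K \<subseteq> N"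
proof -
  have x: "x \<in> topspace T"
    using assms openin_subset by blast
  obtain V C where VC: "openin T V" "compactin T C" "x \<in> V" "V \<subseteq> C"
    using locally_compact x unfolding locally_compact_space_def by blast
  have cc: "connected_component_of_set T x = {x}"
    using totally_disconnected x by (simp add: totally_disconnected_space_def)
  \<comment> \<open>Separating from the complement of \<open>V \<inter> N\<close>, and not just of
    \<open>N\<close>, forces the clopen set into the compact set \<open>C\<close>, which makes it
    compact.\<close>
  have "separated_between T {x} (topspace T - (V \<inter> N))"
  proof (rule separated_between_compact_connected_component[OF locally_compact Hausdorff])
    show "{x} \<in> connected_components_of T"
      using x cc unfolding connected_components_of_def by blast
    show "closedin T (topspace T - (V \<inter> N))"
      using VC assms by (intro closedin_diff) auto
  qed (use x VC assms in auto)
  then obtain K L where K: "openin T K" "openin T L" "K \<union> L = topspace T" "disjnt K L" "x \<in> K"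
    "topspace T - (V \<inter> N) \<subseteq> L"
    unfolding separated_between_def by auto
  then have "K \<subseteq> V \<inter> N"
    by (auto simp: disjnt_iff)
  moreover have "K = topspace T - L"
    using K by (auto simp: disjnt_iff)
  then have "closedin T K"
    using K by auto
  ultimately have "compactin T K"
    using VC closed_compactin by (metis le_inf_iff order_trans)
  then show thesis
    using K \<open>K \<subseteq> V \<inter> N\<close> that by blast
qed

text \<open>A compact open neighbourhood \<open>K\<close> of the identity need not be a subgroup,
  but its stabilizer under right translation is one. It lies in \<open>K\<close> because
  \<open>K\<close> contains the identity, is compact because it is closed, and is open by the tube
  lemma.\<close>

lemma van_Dantzig_one:
  assumes "openin T N" "\<one> \<in> N"
  obtains U where "compact_open_subgroup G T U" "U \<subseteq> N"
proof -
  obtain K where K: "compactin T K" "openin T K" "\<one> \<in> K" "K \<subseteq> N"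
    using assms by (rule compact_open_neighbourhood)
  have clK: "closedin T K"
    using K Hausdorff by (simp add: compactin_imp_closedin)
  have Ksub: "K \<subseteq> carrier G"
    using K openin_subset topspace_eq_carrier by blast
  \<comment> \<open>The stabilizer of \<open>K\<close>, that is all \<open>g\<close> with
    \<open>K #> g = K\<close>, phrased pointwise so that it is an intersection of conditions on
    \<open>g\<close> indexed by \<open>x\<close>.\<close>
  define U where "U = {g \<in> carrier G. \<forall>x\<in>carrier G. x \<otimes> g \<in> K \<longleftrightarrow> x \<in> K}"
  have UK: "U \<subseteq> K"
  proof
    fix g assume "g \<in> U"
    then have "g \<in> carrier G" "\<one> \<otimes> g \<in> K \<longleftrightarrow> \<one> \<in> K"
      unfolding U_def by blast+
    with K(3) show "g \<in> K" by simp
  qed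
  have sub: "subgroup U G"
  proof (rule subgroupI)
    show "U \<noteq> {}"
      by (auto simp: U_def intro!: exI[of _ \<one>])
  next
    fix g assume g: "g \<in> U"
    have "x \<otimes> inv g \<in> K \<longleftrightarrow> x \<in> K" if "x \<in> carrier G" for x
    proof -
      have "x \<otimes> inv g \<otimes> g = x"
        using g that by (simp add: U_def m_assoc)
      moreover have "x \<otimes> inv g \<otimes> g \<in> K \<longleftrightarrow> x \<otimes> inv g \<in> K"
        using g that by (auto simp: U_def)
      ultimately show ?thesis by simp
    qed
    with g show "inv g \<in> U" by (simp add: U_def)
  qed (auto simp: U_def m_assoc[symmetric])
  \<comment> \<open>For fixed \<open>x\<close> the condition places \<open>x \<otimes> g\<close>
    either in \<open>K\<close> or in its complement, and both are closed since \<open>K\<close> is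
    clopen.\<close>
  have "closedin T (\<Inter>x\<in>carrier G. {g \<in> topspace T. x \<otimes> g \<in> K \<longleftrightarrow> x \<in> K})"
  proof (intro closedin_INT)
    fix x assume x: "x \<in> carrier G"
    note cont = continuous_map_left_translation[OF x]
    have "closedin T {g \<in> topspace T. x \<otimes> g \<in> (if x \<in> K then K else topspace T - K)}"
      by (rule closedin_continuous_map_preimage[OF cont]) (use clK K in auto)
    also have "{g \<in> topspace T. x \<otimes> g \<in> (if x \<in> K then K else topspace T - K)}
        = {g \<in> topspace T. x \<otimes> g \<in> K \<longleftrightarrow> x \<in> K}"
      using x by (auto simp: topspace_eq_carrier)
    finally show "closedin T {g \<in> topspace T. x \<otimes> g \<in> K \<longleftrightarrow> x \<in> K}" .
  qed auto
  also have "(\<Inter>x\<in>carrier G. {g \<in> topspace T. x \<otimes> g \<in> K \<longleftrightarrow> x \<in> K}) = U"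
    by (auto simp: U_def topspace_eq_carrier)
  finally have "compactin T U"
    using closed_compactin[OF K(1) UK] by blast
  moreover have "openin T U"
  proof -
    \<comment> \<open>\<open>P\<close> is an open set containing \<open>K \<times> {\<one>}\<close>.
      Compactness of \<open>K\<close> yields a single neighbourhood \<open>V\<close> of the identity
      with \<open>K <#> V\<close> inside \<open>K\<close>.\<close>
    define P where "P = {p \<in> topspace (prod_topology T T). (\<lambda>(x, y). x \<otimes> y) p \<in> K}"
    have "openin (prod_topology T T) P"
      unfolding P_def using K(2) by (intro openin_continuous_map_preimage[OF continuous_map_mult])
    moreover have "K \<times> {\<one>} \<subseteq> P"
      using Ksub by (auto simp: P_def topspace_eq_carrier)
    ultimately obtain V' V where V: "openin T V" "K \<subseteq> V'" "\<one> \<in> V" "V' \<times> V \<subseteq> P"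
      using tube_lemma_left[of T T P K \<one>] K(1) by (auto simp: topspace_eq_carrier)
    \<comment> \<open>Symmetrizing \<open>V\<close> gives both directions of the equivalence
      defining \<open>U\<close>: \<open>g\<close> keeps \<open>K\<close> inside itself, and so does
      \<open>inv g\<close>.\<close>
    define O1 where "O1 = {g \<in> topspace T. g \<in> V \<and> inv g \<in> V}"
    have "openin T (V \<inter> {g \<in> topspace T. inv g \<in> V})"
      using V(1) by (intro openin_Int openin_continuous_map_preimage[OF continuous_map_inv])
    also have "V \<inter> {g \<in> topspace T. inv g \<in> V} = O1"
      by (auto simp: O1_def)
    finally have O1: "openin T O1" .
    have KV: "x \<otimes> g \<in> K" if "x \<in> K" "g \<in> V" for x g
    proof -
      have "(x, g) \<in> P"
        using that V(2,4) by blast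
      then show ?thesis by (simp add: P_def)
    qed
    have "O1 \<subseteq> U"
    proof
      fix g assume g: "g \<in> O1"
      then have gc: "g \<in> carrier G"
        by (simp add: O1_def topspace_eq_carrier)
      have "x \<in> K" if "x \<in> carrier G" "x \<otimes> g \<in> K" for x
        using KV[OF that(2), of "inv g"] g gc that by (simp add: O1_def m_assoc)
      moreover have "x \<otimes> g \<in> K" if "x \<in> K" for x
        using KV[OF that, of g] g by (simp add: O1_def)
      ultimately show "g \<in> U"
        using gc unfolding U_def by blast
    qed
    have one: "\<one> \<in> O1"
      using V by (simp add: O1_def topspace_eq_carrier)
    show ?thesis
    proof (subst openin_subopen, intro ballI)
      fix g assume g: "g \<in> U"
      then have gc: "g \<in> carrier G"
        by (simp add: U_def)
      have "g <# O1 \<subseteq> U"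
        using \<open>O1 \<subseteq> U\<close> subgroup.m_closed[OF sub g] by (auto simp: l_coset_def)
      moreover have "g \<in> g <# O1"
        using one gc by (force simp: l_coset_def)
      ultimately show "\<exists>S. openin T S \<and> g \<in> S \<and> S \<subseteq> U"
        using openin_l_coset[OF gc O1] by blast
    qed
  qed
  ultimately show thesis
    using sub UK K that[of U] by (auto simp: compact_open_subgroup_def)
qed

text \<open>Translating \<open>N\<close> to the identity and back reduces this to
  \<open>van_Dantzig_one\<close>. The compact open cosets thus form a base of the topology.\<close>

lemma van_Dantzig:
  assumes "openin T N" "x \<in> N"
  obtains A where "A \<in> meet_groupoid G T" "x \<in> A" "A \<subseteq> N"
proof -
  have x: "x \<in> carrier G"
    using assms openin_subset topspace_eq_carrier by blast
  have N: "N \<subseteq> carrier G"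
    using assms openin_subset topspace_eq_carrier by blast
  have "openin T (inv x <# N)"
    using x assms(1) by (simp add: openin_l_coset)
  moreover have "\<one> \<in> inv x <# N"
    using x assms(2) by (force simp: l_coset_def)
  ultimately obtain U where U: "compact_open_subgroup G T U" "U \<subseteq> inv x <# N"
    by (rule van_Dantzig_one)
  have "x <# U \<subseteq> x <# (inv x <# N)"
    using U(2) by (auto simp: l_coset_def)
  also have "\<dots> = N"
    using x N by (simp add: lcos_m_assoc lcos_mult_one)
  finally have "x <# U \<subseteq> N" .
  moreover have "x \<in> x <# U"
    using U(1) x by (simp add: compact_open_subgroup_def lcos_self)
  ultimately show thesis
    using that l_coset_in_meet_groupoid[OF U(1) x] by blast
qed

end

section \<open>The power set topology\<close>

lemma topspace_powerset_topology: "topspace (powerset_topology W) = Pow W"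
  by (auto simp: powerset_topology_def topspace_pullback_topology)

text \<open>For \<open>A\<close> in \<open>W\<close> this is a cylinder, the preimage of
  \<open>{b}\<close> under the coordinate \<open>A\<close>; for other \<open>A\<close> it is empty
  or the whole space.\<close>

lemma openin_powerset_topology_member:
  "openin (powerset_topology W) {J \<in> Pow W. (A \<in> J) = b}"
proof (cases "A \<in> W")
  case True
  have "continuous_map (powerset_topology W) (discrete_topology UNIV)
      ((\<lambda>f. f A) \<circ> (\<lambda>J. \<lambda>A\<in>W. A \<in> J))"
    unfolding powerset_topology_def
    using True by (intro continuous_map_pullback continuous_map_product_projection)
  from openin_continuous_map_preimage[OF this, of "{b}"] True show ?thesis
    by (simp add: topspace_powerset_topology)
next
  case False
  then have "{J \<in> Pow W. (A \<in> J) = b} = (if b then {} else topspace (powerset_topology W))"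
    by (auto simp: topspace_powerset_topology)
  then show ?thesis by (metis openin_empty openin_topspace)
qed

lemma openin_powerset_topology_basic:
  assumes "finite E" "finite F"
  shows "openin (powerset_topology W) {J \<in> Pow W. F \<subseteq> J \<and> E \<inter> J = {}}"
proof -
  \<comment> \<open>Intersecting with the whole space gives the right value when \<open>E\<close>
    and \<open>F\<close> are both empty, where the bare intersection would be
    \<open>UNIV\<close>.\<close>
  have "openin (powerset_topology W) (topspace (powerset_topology W) \<inter>
      \<Inter> ((\<lambda>A. {J \<in> Pow W. (A \<in> J) = True}) ` F \<union> (\<lambda>A. {J \<in> Pow W. (A \<in> J) = False}) ` E))"
    using assms by (intro openin_Int_Inter) (auto simp del: Pow_iff eq_True eq_False
        intro: openin_powerset_topology_member)
  also have "topspace (powerset_topology W) \<inter>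
      \<Inter> ((\<lambda>A. {J \<in> Pow W. (A \<in> J) = True}) ` F \<union> (\<lambda>A. {J \<in> Pow W. (A \<in> J) = False}) ` E) =
      {J \<in> Pow W. F \<subseteq> J \<and> E \<inter> J = {}}"
    by (auto simp: topspace_powerset_topology)
  finally show ?thesis .
qed

text \<open>Tychonoff's theorem gives compactness of the product of two-point spaces, and the map
  \<open>?g\<close> from characteristic functions to subsets carries it over.\<close>

lemma compact_space_powerset_topology: "compact_space (powerset_topology W)"
proof -
  let ?P = "product_topology (\<lambda>_. discrete_topology (UNIV :: bool set)) W"
  let ?g = "\<lambda>f. {A \<in> W. f A}"
  have "continuous_map ?P ?P (\<lambda>f. f)"
    by simp
  \<comment> \<open>Taking the characteristic function of \<open>?g f\<close> returns
    \<open>f\<close> on the product, so continuity of \<open>?g\<close> into the pullback topology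
    reduces to that of the identity.\<close>
  then have "continuous_map ?P ?P ((\<lambda>J. \<lambda>A\<in>W. A \<in> J) \<circ> ?g)"
    by (rule continuous_map_eq) (auto simp: PiE_def extensional_def fun_eq_iff)
  then have "continuous_map ?P (powerset_topology W) ?g"
    unfolding powerset_topology_def by (rule continuous_map_pullback') auto
  moreover have "compact_space ?P"
    by (simp add: compact_space_product_topology compact_space_discrete_topology)
  ultimately have "compactin (powerset_topology W) (?g ` topspace ?P)"
    by (simp add: image_compactin compact_space_def)
  moreover have "?g ` topspace ?P = Pow W"
  proof (intro equalityI subsetI)
    fix J assume "J \<in> Pow W"
    then have "J = ?g (\<lambda>A\<in>W. A \<in> J)" "(\<lambda>A\<in>W. A \<in> J) \<in> topspace ?P"
      by auto
    then show "J \<in> ?g ` topspace ?P" by (rule image_eqI)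
  qed auto
  ultimately show ?thesis
    by (simp add: compact_space_def topspace_powerset_topology)
qed

section \<open>Closed-subgroup ideals and closed subgroups\<close>

definition avoiding_ideal :: "('a, 'b) monoid_scheme \<Rightarrow> 'a topology \<Rightarrow> 'a set \<Rightarrow> 'a set set" where
  "avoiding_ideal G T S = {A \<in> meet_groupoid G T. A \<inter> S = {}}"

lemma closed_subgroup_ideal_subset:
  "J \<in> closed_subgroup_ideals G T \<Longrightarrow> A \<in> J \<Longrightarrow> A \<in> meet_groupoid G T"
  by (auto simp: closed_subgroup_ideals_def mg_ideal_def)

lemma closed_subgroup_ideal_set_inv:
  "J \<in> closed_subgroup_ideals G T \<Longrightarrow> A \<in> J \<Longrightarrow> set_inv\<^bsub>G\<^esub> A \<in> J"
  by (auto simp: closed_subgroup_ideals_def)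

lemma closed_subgroup_ideal_cover:
  assumes "J \<in> closed_subgroup_ideals G T" "finite F" "F \<subseteq> J" "A \<in> meet_groupoid G T" "A \<subseteq> \<Union>F"
  shows "A \<in> J"
  using assms by (auto simp: closed_subgroup_ideals_def mg_ideal_def)

text \<open>The nonemptiness of both factors is derived from \<open>C \<noteq> {}\<close>, since a
  product with an empty factor is empty.\<close>

lemma closed_subgroup_ideal_product:
  assumes "J \<in> closed_subgroup_ideals G T" "A \<in> meet_groupoid G T" "B \<in> meet_groupoid G T"
    "mg_product G A B = Some C" "C \<in> J" "C \<noteq> {}"
  shows "A \<in> J \<or> B \<in> J"
proof -
  have "A \<noteq> {}" "B \<noteq> {}"
    using assms(4,6) by (auto simp: mg_product_def set_mult_def split: if_splits)
  with assms show ?thesis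
    unfolding closed_subgroup_ideals_def by blast
qed

section \<open>From ideals to closed subgroups\<close>

context topological_group
begin

text \<open>Members of \<open>J\<close> are open, so compactness reduces any cover by
  \<open>J\<close> to the finite covers appearing in the ideal axiom.\<close>

lemma csi_cover_compactin:
  assumes "J \<in> closed_subgroup_ideals G T" "compactin T K" "K \<subseteq> \<Union>J"
  obtains F where "finite F" "F \<subseteq> J" "K \<subseteq> \<Union>F"
proof -
  have "\<forall>A\<in>J. openin T A"
    using closed_subgroup_ideal_subset[OF assms(1)] meet_groupoid_openin by blast
  with assms that show thesis
    unfolding compactin_def by meson
qed

text \<open>Since \<open>(aU)\<inverse> \<cdot> (aU) = U\<close>, an ideal containing \<open>U\<close> contains every left coset of \<open>U\<close>, and these
  cover every compact set by finitely many.\<close>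

lemma csi_no_subgroup:
  assumes J: "J \<in> closed_subgroup_ideals G T" and U: "compact_open_subgroup G T U"
  shows "U \<notin> J"
proof
  assume "U \<in> J"
  have sub: "subgroup U G"
    using U by (simp add: compact_open_subgroup_def)
  have cosets: "a <# U \<in> J" if a: "a \<in> carrier G" for a
  proof -
    \<comment> \<open>With this \<open>V\<close>, the coset \<open>inv a <# V\<close> equals
      \<open>U #> inv a\<close>, the inverse of \<open>a <# U\<close>. Whichever factor the product
      condition puts into \<open>J\<close>, inversion then puts \<open>a <# U\<close> there.\<close>
    define V where "V = (a <# U) #> inv a"
    note fact = mg_product_factorization[OF U inv_closed[OF a] a, folded V_def]
    have "inv a <# V \<in> J \<or> a <# U \<in> J"
    proof (rule closed_subgroup_ideal_product[OF J])
      show "mg_product G (inv a <# V) (a <# U) = Some U"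
        using fact(1) a sub by (simp add: lcos_mult_one subgroup.subset)
    qed (use fact(2) \<open>U \<in> J\<close> l_coset_in_meet_groupoid[OF U a] subgroup.one_closed[OF sub] in auto)
    moreover have "set_inv (inv a <# V) = a <# U"
    proof -
      have "set_inv (inv a <# V) = V #> inv (inv a)"
        using a subgroup_conjugate[OF sub a] by (intro set_inv_l_coset) (auto simp: V_def)
      then show ?thesis
        using a l_coset_eq_r_coset_conjugate[OF subgroup.subset[OF sub] a] by (simp add: V_def)
    qed
    ultimately show ?thesis
      using closed_subgroup_ideal_set_inv[OF J] by metis
  qed
  have "carrier G \<subseteq> \<Union>J"
    using cosets lcos_self[OF _ sub] by blast
  have "meet_groupoid G T \<subseteq> J"
  proof
    fix A assume A: "A \<in> meet_groupoid G T"
    then have "compactin T A" "A \<subseteq> \<Union>J"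
      using meet_groupoid_compactin meet_groupoid_subset \<open>carrier G \<subseteq> \<Union>J\<close> by blast+
    then obtain F where "finite F" "F \<subseteq> J" "A \<subseteq> \<Union>F"
      using csi_cover_compactin[OF J] by blast
    then show "A \<in> J"
      using closed_subgroup_ideal_cover[OF J] A by blast
  qed
  with J show False
    by (auto simp: closed_subgroup_ideals_def mg_ideal_def)
qed

text \<open>Injectivity of \<Gamma>: by compactness of its members, an ideal is determined by its
  union.\<close>

lemma avoiding_ideal_ideal_subgroup:
  assumes J: "J \<in> closed_subgroup_ideals G T"
  shows "avoiding_ideal G T (ideal_subgroup G J) = J"
proof (intro equalityI subsetI)
  fix A assume "A \<in> avoiding_ideal G T (ideal_subgroup G J)"
  then have A: "A \<in> meet_groupoid G T" "A \<subseteq> \<Union>J"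
    using meet_groupoid_subset by (auto simp: avoiding_ideal_def ideal_subgroup_def)
  then obtain F where "finite F" "F \<subseteq> J" "A \<subseteq> \<Union>F"
    using csi_cover_compactin[OF J meet_groupoid_compactin] by blast
  then show "A \<in> J"
    using closed_subgroup_ideal_cover[OF J] A by blast
qed (use closed_subgroup_ideal_subset[OF J] in \<open>auto simp: avoiding_ideal_def ideal_subgroup_def\<close>)

text \<open>Each subgroup axiom comes from one condition on \<open>J\<close>: the identity from
  properness through \<open>csi_no_subgroup\<close>, inverses from closure under inversion, and
  products from the product condition.\<close>

lemma ideal_subgroup_closed_subgroup:
  assumes J: "J \<in> closed_subgroup_ideals G T"
  shows "ideal_subgroup G J \<in> closed_subgroups G T"
proof -
  let ?S = "ideal_subgroup G J"
  have "openin T (\<Union>J)"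
    using closed_subgroup_ideal_subset[OF J] meet_groupoid_openin by blast
  then have "closedin T ?S"
    by (auto simp: ideal_subgroup_def topspace_eq_carrier[symmetric])
  moreover have "subgroup ?S G"
  proof
    show "?S \<subseteq> carrier G"
      by (auto simp: ideal_subgroup_def)
    show "\<one> \<in> ?S"
    proof (rule ccontr)
      assume "\<one> \<notin> ?S"
      then obtain A where A: "A \<in> J" "\<one> \<in> A"
        by (auto simp: ideal_subgroup_def)
      from closed_subgroup_ideal_subset[OF J A(1)] A(2) obtain U
        where U: "compact_open_subgroup G T U" "A = \<one> <# U"
        by (rule meet_groupoid_l_cosetE)
      then have "A = U"
        by (simp add: compact_open_subgroup_def lcos_mult_one subgroup.subset)
      with A(1) csi_no_subgroup[OF J U(1)] show False by simp
    qed
  next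
    fix x assume x: "x \<in> ?S"
    then have xc: "x \<in> carrier G" by (simp add: ideal_subgroup_def)
    have False if "A \<in> J" "inv x \<in> A" for A
    proof -
      have "x \<in> set_inv A"
        using that(2) xc by (force simp: SET_INV_def)
      with closed_subgroup_ideal_set_inv[OF J that(1)] x show False
        by (auto simp: ideal_subgroup_def)
    qed
    with xc show "inv x \<in> ?S"
      by (auto simp: ideal_subgroup_def)
  next
    fix a b assume ab: "a \<in> ?S" "b \<in> ?S"
    then have c: "a \<in> carrier G" "b \<in> carrier G"
      by (auto simp: ideal_subgroup_def)
    \<comment> \<open>The coset \<open>C\<close> factors into one coset through \<open>a\<close> and
      one through \<open>b\<close>; one of them would lie in \<open>J\<close>, although
      \<open>a\<close> and \<open>b\<close> avoid the union of \<open>J\<close>.\<close>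
    have False if C: "C \<in> J" "a \<otimes> b \<in> C" for C
    proof -
      from closed_subgroup_ideal_subset[OF J C(1)] C(2) obtain U
        where U: "compact_open_subgroup G T U" "C = (a \<otimes> b) <# U"
        by (rule meet_groupoid_l_cosetE)
      define V where "V = (b <# U) #> inv b"
      have sub: "subgroup U G" "subgroup V G"
        using U c by (auto simp: compact_open_subgroup_def V_def subgroup_conjugate)
      note fact = mg_product_factorization[OF U(1) c, folded V_def]
      have "a <# V \<in> J \<or> b <# U \<in> J"
        using fact U C c l_coset_in_meet_groupoid
        by (intro closed_subgroup_ideal_product[OF J]) auto
      then show False
        using ab sub c lcos_self by (auto simp: ideal_subgroup_def)
    qed
    with c show "a \<otimes> b \<in> ?S"
      by (auto simp: ideal_subgroup_def)
  qed
  ultimately show ?thesis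
    by (simp add: closed_subgroups_def)
qed

end

section \<open>From closed subgroups to ideals\<close>

context tdlc_group
begin

lemma compact_open_subgroup_exists:
  obtains U where "compact_open_subgroup G T U"
  using van_Dantzig_one[OF openin_topspace] topspace_eq_carrier that by auto

text \<open>The complement of \<open>S\<close> is open, so van Dantzig's theorem places each of its
  points in a compact open coset avoiding \<open>S\<close>.\<close>

lemma ideal_subgroup_avoiding_ideal:
  assumes "S \<in> closed_subgroups G T"
  shows "ideal_subgroup G (avoiding_ideal G T S) = S"
proof -
  have S: "subgroup S G" "openin T (topspace T - S)"
    using assms by (auto simp: closed_subgroups_def)
  have "\<exists>A\<in>avoiding_ideal G T S. x \<in> A" if "x \<in> carrier G" "x \<notin> S" for x
  proof -
    have "x \<in> topspace T - S"
      using that by (simp add: topspace_eq_carrier)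
    with S(2) obtain A where "A \<in> meet_groupoid G T" "x \<in> A" "A \<subseteq> topspace T - S"
      by (rule van_Dantzig)
    then show ?thesis
      by (auto simp: avoiding_ideal_def)
  qed
  then show ?thesis
    using subgroup.subset[OF S(1)] by (auto simp: ideal_subgroup_def avoiding_ideal_def)
qed

text \<open>The subgroup axioms for \<open>S\<close> are used in contrapositive form: the identity
  gives properness, inverses give closure under inversion, and if both factors met \<open>S\<close>
  then so would their product.\<close>

lemma avoiding_ideal_csi:
  assumes "S \<in> closed_subgroups G T"
  shows "avoiding_ideal G T S \<in> closed_subgroup_ideals G T"
proof -
  let ?J = "avoiding_ideal G T S"
  have sub: "subgroup S G"
    using assms by (simp add: closed_subgroups_def)
  have "mg_ideal (meet_groupoid G T) ?J"
    unfolding mg_ideal_def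
  proof (intro conjI allI impI)
    show "{} \<in> ?J"
      by (simp add: avoiding_ideal_def meet_groupoid_def)
  qed (auto simp: avoiding_ideal_def)
  moreover have "?J \<noteq> meet_groupoid G T"
  proof -
    obtain U where U: "compact_open_subgroup G T U"
      by (rule compact_open_subgroup_exists)
    then have "\<one> \<in> U \<inter> S"
      using sub by (auto simp: compact_open_subgroup_def subgroup.one_closed)
    then have "U \<notin> ?J"
      by (auto simp: avoiding_ideal_def)
    with compact_open_subgroup_in_meet_groupoid[OF U] show ?thesis by blast
  qed
  moreover have "set_inv A \<in> ?J" if "A \<in> ?J" for A
  proof -
    have A: "A \<in> meet_groupoid G T" "A \<inter> S = {}"
      using that by (auto simp: avoiding_ideal_def)
    have "inv x \<notin> S" if "x \<in> A" for x
      using that A subsetD[OF meet_groupoid_subset[OF A(1)]] subgroup.m_inv_closed[OF sub, of "inv x"] by auto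
    then show ?thesis
      using set_inv_in_meet_groupoid[OF A(1)] by (auto simp: avoiding_ideal_def SET_INV_def)
  qed
  moreover have "A \<in> ?J \<or> B \<in> ?J"
    if AB: "A \<in> meet_groupoid G T - {{}}" "B \<in> meet_groupoid G T - {{}}"
      and prod: "mg_product G A B = Some C" and C: "C \<in> ?J" for A B C
  proof (rule ccontr)
    assume "\<not> (A \<in> ?J \<or> B \<in> ?J)"
    then obtain a b where ab: "a \<in> A" "a \<in> S" "b \<in> B" "b \<in> S"
      using AB by (auto simp: avoiding_ideal_def)
    have "C = A <#> B"
      using AB prod by (auto simp: mg_product_def split: if_splits)
    then have "a \<otimes> b \<in> C"
      using ab by (auto simp: set_mult_def)
    with subgroup.m_closed[OF sub ab(2,4)] C show False
      by (auto simp: avoiding_ideal_def)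
  qed
  ultimately show ?thesis
    unfolding closed_subgroup_ideals_def by blast
qed

lemma bij_betw_ideal_subgroup:
  "bij_betw (ideal_subgroup G) (closed_subgroup_ideals G T) (closed_subgroups G T)"
  using ideal_subgroup_closed_subgroup avoiding_ideal_csi
    avoiding_ideal_ideal_subgroup ideal_subgroup_avoiding_ideal
  by (intro bij_betwI[where g = "avoiding_ideal G T"]) auto

section \<open>Compactness and continuity\<close>

text \<open>By \<open>csi_no_subgroup\<close> properness amounts to not containing one fixed compact open subgroup, so
  every failure of membership is witnessed by finitely many elements of the meet groupoid.\<close>

lemma closedin_csi:
  "closedin (powerset_topology (meet_groupoid G T)) (closed_subgroup_ideals G T)"
proof -
  let ?W = "meet_groupoid G T" and ?C = "closed_subgroup_ideals G T"
  obtain U where U: "compact_open_subgroup G T U"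
    by (rule compact_open_subgroup_exists)
  \<comment> \<open>\<open>F\<close> and \<open>E\<close> record finitely many memberships and
    non-memberships of \<open>J\<close> that no closed-subgroup ideal shares; they determine a basic
    neighbourhood of \<open>J\<close> outside \<open>?C\<close>.\<close>
  have witness: "\<exists>E F. finite E \<and> finite F \<and> F \<subseteq> J \<and> E \<inter> J = {} \<and>
      (\<forall>J'\<in>?C. F \<subseteq> J' \<longrightarrow> E \<inter> J' \<noteq> {})" if J: "J \<in> Pow ?W" "J \<notin> ?C" for J
  proof -
    consider "{} \<notin> J"
      | (cover) A F where "finite F" "F \<subseteq> J" "A \<in> ?W" "A \<subseteq> \<Union>F" "A \<notin> J"
      | "U \<in> J" | (inverse) A where "A \<in> J" "set_inv A \<notin> J"
      | (product) A B C where "A \<in> ?W - {{}}" "B \<in> ?W - {{}}" "mg_product G A B = Some C"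
          "C \<in> J" "A \<notin> J" "B \<notin> J"
    proof (rule ccontr)
      assume neg: "\<not> thesis"
      have "mg_ideal ?W J"
        unfolding mg_ideal_def using J(1) neg that(1,2) by blast
      moreover have "J \<noteq> ?W"
        using neg that(3) compact_open_subgroup_in_meet_groupoid[OF U] by blast
      moreover have "\<forall>A\<in>J. set_inv A \<in> J"
        using neg that(4) by blast
      moreover have "\<forall>A\<in>?W - {{}}. \<forall>B\<in>?W - {{}}. \<forall>C.
          mg_product G A B = Some C \<and> C \<in> J \<longrightarrow> A \<in> J \<or> B \<in> J"
        using neg that(5) by blast
      ultimately show False
        using J(2) by (simp add: closed_subgroup_ideals_def)
    qed
    then show ?thesis
    proof cases
      case 1
      then show ?thesis
        by (intro exI[of _ "{{}}"] exI[of _ "{}"]) (auto simp: closed_subgroup_ideals_def mg_ideal_def)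
    next
      case (cover A F)
      then show ?thesis
        by (intro exI[of _ "{A}"] exI[of _ F]) (auto intro: closed_subgroup_ideal_cover)
    next
      case 3
      then show ?thesis
        using csi_no_subgroup[OF _ U] by (intro exI[of _ "{}"] exI[of _ "{U}"]) auto
    next
      case (inverse A)
      then show ?thesis
        by (intro exI[of _ "{set_inv A}"] exI[of _ "{A}"]) (auto simp: closed_subgroup_ideal_set_inv)
    next
      case (product A B C)
      then show ?thesis
        by (intro exI[of _ "{A, B}"] exI[of _ "{C}"]) (auto simp: closed_subgroup_ideals_def)
    qed
  qed
  have "openin (powerset_topology ?W) (Pow ?W - ?C)"
  proof (subst openin_subopen, intro ballI)
    fix J assume "J \<in> Pow ?W - ?C"
    with witness obtain E F where *: "finite E" "finite F" "F \<subseteq> J" "E \<inter> J = {}"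
      "\<forall>J'\<in>?C. F \<subseteq> J' \<longrightarrow> E \<inter> J' \<noteq> {}" "J \<in> Pow ?W"
      by (metis DiffD1 DiffD2)
    then show "\<exists>X. openin (powerset_topology ?W) X \<and> J \<in> X \<and> X \<subseteq> Pow ?W - ?C"
      by (intro exI[of _ "{J \<in> Pow ?W. F \<subseteq> J \<and> E \<inter> J = {}}"] conjI openin_powerset_topology_basic)
        blast+
  qed
  then show ?thesis
    by (auto simp: closedin_def topspace_powerset_topology closed_subgroup_ideals_def mg_ideal_def)
qed

lemma compact_space_csi_topology: "compact_space (csi_topology G T)"
  unfolding csi_topology_def
  by (intro compact_space_subtopology closedin_compact_space compact_space_powerset_topology closedin_csi)

section \<open>Continuity of \<Gamma>\<close>

lemma openin_csi_topology_basic: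
  assumes "finite E" "finite F"
  shows "openin (csi_topology G T) {J \<in> closed_subgroup_ideals G T. F \<subseteq> J \<and> E \<inter> J = {}}"
proof -
  have "{J \<in> closed_subgroup_ideals G T. F \<subseteq> J \<and> E \<inter> J = {}} =
      {J \<in> Pow (meet_groupoid G T). F \<subseteq> J \<and> E \<inter> J = {}} \<inter> closed_subgroup_ideals G T"
    using closed_subgroup_ideal_subset by blast
  with openin_powerset_topology_basic[OF assms] show ?thesis
    unfolding csi_topology_def openin_subtopology by (intro exI conjI)
qed

text \<open>Avoiding \<open>K\<close> means that \<open>J\<close> covers \<open>K\<close>, which
  finitely many members of \<open>J\<close> already do. Meeting \<open>R\<close> is witnessed by one
  coset inside \<open>R\<close> that is not in \<open>J\<close>. These finitely many conditions
  define a neighbourhood of \<open>J\<close> within the preimage.\<close>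

lemma openin_csi_preimage_chabauty_basic:
  assumes "compactin T K" "finite \<R>" "\<forall>R\<in>\<R>. openin T R"
  shows "openin (csi_topology G T)
      {J \<in> closed_subgroup_ideals G T. ideal_subgroup G J \<in> chabauty_basic G T K \<R>}"
proof (subst openin_subopen, intro ballI)
  fix J assume "J \<in> {J \<in> closed_subgroup_ideals G T. ideal_subgroup G J \<in> chabauty_basic G T K \<R>}"
  then have J: "J \<in> closed_subgroup_ideals G T" "ideal_subgroup G J \<inter> K = {}"
      "\<forall>R\<in>\<R>. ideal_subgroup G J \<inter> R \<noteq> {}"
    by (auto simp: chabauty_basic_def)
  have "K \<subseteq> \<Union>J"
    using J(2) compactin_subset_topspace[OF assms(1)] by (auto simp: ideal_subgroup_def topspace_eq_carrier)
  with J(1) assms(1) obtain F where F: "finite F" "F \<subseteq> J" "K \<subseteq> \<Union>F"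
    by (rule csi_cover_compactin)
  have "\<exists>A\<in>meet_groupoid G T. A \<subseteq> R \<and> A \<notin> J" if R: "R \<in> \<R>" for R
  proof -
    from J(3) R obtain x where x: "x \<in> ideal_subgroup G J" "x \<in> R"
      by blast
    have "openin T R"
      using R assms(3) by blast
    then obtain A where "A \<in> meet_groupoid G T" "x \<in> A" "A \<subseteq> R"
      using x(2) by (rule van_Dantzig)
    with x(1) show ?thesis
      by (auto simp: ideal_subgroup_def)
  qed
  then obtain A where A: "\<And>R. R \<in> \<R> \<Longrightarrow> A R \<in> meet_groupoid G T \<and> A R \<subseteq> R \<and> A R \<notin> J"
    by metis
  let ?X = "{J' \<in> closed_subgroup_ideals G T. F \<subseteq> J' \<and> A ` \<R> \<inter> J' = {}}"
  have "openin (csi_topology G T) ?X"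
    using F assms by (intro openin_csi_topology_basic) auto
  moreover have "J \<in> ?X"
    using J F A by auto
  moreover have "?X \<subseteq> {J \<in> closed_subgroup_ideals G T. ideal_subgroup G J \<in> chabauty_basic G T K \<R>}"
  proof
    fix J' assume J': "J' \<in> ?X"
    have csi: "J' \<in> closed_subgroup_ideals G T" and "F \<subseteq> J'" and disj: "A ` \<R> \<inter> J' = {}"
      using J' by simp_all
    have "K \<subseteq> \<Union>J'"
      using F(3) Union_mono[OF \<open>F \<subseteq> J'\<close>] by (rule order_trans)
    then have "ideal_subgroup G J' \<inter> K = {}"
      by (auto simp: ideal_subgroup_def)
    moreover have "ideal_subgroup G J' \<inter> R \<noteq> {}" if R: "R \<in> \<R>" for R
    proof -
      \<comment> \<open>Since \<open>J'\<close> is recovered from its subgroup, a coset outside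
        \<open>J'\<close> must meet that subgroup.\<close>
      have "A R \<notin> avoiding_ideal G T (ideal_subgroup G J')"
        using disj R avoiding_ideal_ideal_subgroup[OF csi] by auto
      with A[OF R] show ?thesis
        by (auto simp: avoiding_ideal_def)
    qed
    ultimately have "ideal_subgroup G J' \<in> chabauty_basic G T K \<R>"
      using ideal_subgroup_closed_subgroup[OF csi] by (simp add: chabauty_basic_def)
    with csi show "J' \<in> {J \<in> closed_subgroup_ideals G T. ideal_subgroup G J \<in> chabauty_basic G T K \<R>}"
      by simp
  qed
  ultimately show "\<exists>X. openin (csi_topology G T) X \<and> J \<in> X \<and>
      X \<subseteq> {J \<in> closed_subgroup_ideals G T. ideal_subgroup G J \<in> chabauty_basic G T K \<R>}"
    by (intro exI[of _ ?X] conjI)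
qed

lemma continuous_map_ideal_subgroup:
  "continuous_map (csi_topology G T) (chabauty_topology G T) (ideal_subgroup G)"
  unfolding continuous_map_def topspace_csi_topology topspace_chabauty_topology
proof (intro conjI allI impI)
  show "ideal_subgroup G \<in> closed_subgroup_ideals G T \<rightarrow> closed_subgroups G T"
    by (intro Pi_I ideal_subgroup_closed_subgroup)
next
  fix X assume "openin (chabauty_topology G T) X"
  then obtain \<U> where \<U>: "\<forall>Y\<in>\<U>. is_chabauty_basic G T Y" "X = \<Union>\<U>"
    by (auto simp: openin_chabauty_topology union_of_def)
  have "openin (csi_topology G T)
      (\<Union>Y\<in>\<U>. {J \<in> closed_subgroup_ideals G T. ideal_subgroup G J \<in> Y})"
    using \<U>(1) openin_csi_preimage_chabauty_basic
    by (intro openin_Union) (auto simp: is_chabauty_basic_def)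
  also have "(\<Union>Y\<in>\<U>. {J \<in> closed_subgroup_ideals G T. ideal_subgroup G J \<in> Y}) =
      {J \<in> closed_subgroup_ideals G T. ideal_subgroup G J \<in> X}"
    using \<U>(2) by auto
  finally show "openin (csi_topology G T) {J \<in> closed_subgroup_ideals G T. ideal_subgroup G J \<in> X}" .
qed

section \<open>Separation in the Chabauty space\<close>

lemma openin_chabauty_basic:
  assumes "compactin T K" "finite \<R>" "\<forall>R\<in>\<R>. openin T R"
  shows "openin (chabauty_topology G T) (chabauty_basic G T K \<R>)"
proof -
  have "is_chabauty_basic G T (chabauty_basic G T K \<R>)"
    using assms unfolding is_chabauty_basic_def by blast
  then show ?thesis
    by (simp add: openin_chabauty_topology arbitrary_def union_of_inc)
qed

text \<open>A compact open coset meeting one of two distinct closed subgroups and avoiding the other gives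
  complementary open sets.\<close>

lemma Hausdorff_space_chabauty_topology: "Hausdorff_space (chabauty_topology G T)"
  unfolding Hausdorff_space_def topspace_chabauty_topology
proof (intro allI impI)
  \<comment> \<open>A point of \<open>S\<close> outside \<open>S'\<close> lies in some member of the
    ideal avoiding \<open>S'\<close>, because that ideal covers the complement of
    \<open>S'\<close>.\<close>
  have sep: "\<exists>A\<in>meet_groupoid G T. A \<inter> S \<noteq> {} \<and> A \<inter> S' = {}"
    if "S \<in> closed_subgroups G T" "S' \<in> closed_subgroups G T" "\<not> S \<subseteq> S'" for S S'
    using that ideal_subgroup_avoiding_ideal[of S'] subgroup.subset[of S]
    by (fastforce simp: ideal_subgroup_def avoiding_ideal_def closed_subgroups_def)
  fix S S' assume "S \<in> closed_subgroups G T \<and> S' \<in> closed_subgroups G T \<and> S \<noteq> S'"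
  then have *: "S \<in> closed_subgroups G T" "S' \<in> closed_subgroups G T" "S \<noteq> S'"
    by auto
  have basic: "openin (chabauty_topology G T) (chabauty_basic G T A {})"
    "openin (chabauty_topology G T) (chabauty_basic G T {} {A})" if "A \<in> meet_groupoid G T" for A
    using that by (auto intro!: openin_chabauty_basic meet_groupoid_compactin meet_groupoid_openin)
  have disj: "disjnt (chabauty_basic G T A {}) (chabauty_basic G T {} {A})"
     "disjnt (chabauty_basic G T {} {A}) (chabauty_basic G T A {})" for A
    by (auto simp: disjnt_iff chabauty_basic_def)
  from *(3) consider "\<not> S \<subseteq> S'" | "\<not> S' \<subseteq> S" by blast
  then show "\<exists>X Y. openin (chabauty_topology G T) X \<and> openin (chabauty_topology G T) Y \<and>
      S \<in> X \<and> S' \<in> Y \<and> disjnt X Y"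
  proof cases
    case 1
    from sep[OF *(1,2) this] obtain A where A: "A \<in> meet_groupoid G T" "A \<inter> S \<noteq> {}" "A \<inter> S' = {}"
      by blast
    then have "S \<in> chabauty_basic G T {} {A}" "S' \<in> chabauty_basic G T A {}"
      using * by (auto simp: chabauty_basic_def)
    with basic[OF A(1)] disj show ?thesis
      by (intro exI[of _ "chabauty_basic G T {} {A}"] exI[of _ "chabauty_basic G T A {}"] conjI)
  next
    case 2
    from sep[OF *(2,1) this] obtain A where A: "A \<in> meet_groupoid G T" "A \<inter> S' \<noteq> {}" "A \<inter> S = {}"
      by blast
    then have "S \<in> chabauty_basic G T A {}" "S' \<in> chabauty_basic G T {} {A}"
      using * by (auto simp: chabauty_basic_def)
    with basic[OF A(1)] disj show ?thesis
      by (intro exI[of _ "chabauty_basic G T A {}"] exI[of _ "chabauty_basic G T {} {A}"] conjI)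
  qed
qed

end

theorem proposition7p5:
  fixes G :: "('a, 'b) monoid_scheme" and T :: "'a topology"
  assumes "tdlc_group G T"
  shows "compact_space (csi_topology G T) \<and>
         compact_space (chabauty_topology G T) \<and>
         continuous_map (csi_topology G T) (chabauty_topology G T) (ideal_subgroup G) \<and>
         bij_betw (ideal_subgroup G) (closed_subgroup_ideals G T) (closed_subgroups G T) \<and>
         homeomorphic_map (csi_topology G T) (chabauty_topology G T) (ideal_subgroup G)"
proof -
  interpret tdlc_group G T by fact
  note bij = bij_betw_ideal_subgroup
  have surj: "ideal_subgroup G ` topspace (csi_topology G T) = topspace (chabauty_topology G T)"
    using bij by (simp add: bij_betw_def topspace_csi_topology topspace_chabauty_topology)
  \<comment> \<open>A continuous map from a compact space to a Hausdorff space is closed, and a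
    continuous closed bijection is a homeomorphism.\<close>
  have "homeomorphic_map (csi_topology G T) (chabauty_topology G T) (ideal_subgroup G)"
    using bij surj continuous_map_ideal_subgroup
    by (intro bijective_closed_imp_homeomorphic_map continuous_imp_closed_map
        compact_space_csi_topology Hausdorff_space_chabauty_topology)
      (auto simp: bij_betw_def topspace_csi_topology)
  \<comment> \<open>The Chabauty space inherits compactness as the continuous image of the space of
    ideals.\<close>
  moreover have "compact_space (chabauty_topology G T)"
    using image_compactin[OF _ continuous_map_ideal_subgroup, of "topspace (csi_topology G T)"]
      compact_space_csi_topology by (simp add: compact_space_def surj)
  ultimately show ?thesis
    using compact_space_csi_topology continuous_map_ideal_subgroup bij by blast
qed

end
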